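(* Let $A_1A_2A_3$ be an equilateral triangle in the Euclidean plane with circumradius $R>0$ and centroid $O$. For every real constant $c>3R^4$, the locus of points $M$ of the plane such that $$\sum_{i=1}^{3} d_i^4=c,\qquad d_i=|MA_i|,$$ is a circle whose center is the centroid $O$.
   Context: $|MA_i|$ denotes the Euclidean distance from $M$ to $A_i$. A circle means a circle of positive radius. *)

theory Defs
  imports "HOL-Analysis.Analysis"
begin

text \<open>
  A triangle is given by its vertices \<open>A 1\<close>, \<open>A 2\<close>, \<open>A 3\<close>; other values of \<open>A\<close> are irrelevant.
  Non-collinearity excludes the degenerate case of three coinciding points.
\<close>

definition equilateral_triangle :: "(nat \<Rightarrow> real^2) \<Rightarrow> bool" where
  "equilateral_triangle A \<longleftrightarrow>
     \<not> collinear {A 1, A 2, A 3} \<and>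
     dist (A 1) (A 2) = dist (A 2) (A 3) \<and>
     dist (A 2) (A 3) = dist (A 3) (A 1)"

definition centroid :: "(nat \<Rightarrow> real^2) \<Rightarrow> real^2" where
  "centroid A = (1/3) *\<^sub>R (\<Sum>i=1..3. A i)"

text \<open>The circumcenter \<open>P\<close> is not presupposed to be the centroid.\<close>

definition is_circumradius :: "real \<Rightarrow> (nat \<Rightarrow> real^2) \<Rightarrow> bool" where
  "is_circumradius R A \<longleftrightarrow> (\<exists>P. \<forall>i\<in>{1..3}. A i \<in> sphere P R)"

end

theory Submission
  imports Defs
begin

text \<open>
  Any three plane vectors have vanishing Gram determinant. Applied to the vectors from the
  circumcenter to the vertices, this forces their pairwise inner products to be \<open>- R\<^sup>2 / 2\<close>, so that
  they sum to \<open>0\<close> and the circumcenter is the centroid \<open>O\<close>. Applied to \<open>x = M - O\<close> and two of these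
  vectors, it gives \<open>\<Sum> (x \<bullet> u\<^sub>i)\<^sup>2 = 3 R\<^sup>2 |x|\<^sup>2 / 2\<close>, whence
  \<open>\<Sum> d\<^sub>i\<^sup>4 = 3 ((|x|\<^sup>2 + 2 R\<^sup>2)\<^sup>2 - 3 R\<^sup>4)\<close> depends on \<open>|x|\<close> only.
\<close>

text \<open>Three vectors in a plane are linearly dependent, so their Gram matrix is singular. The
  negative terms of its determinant are moved to the right.\<close>

lemma gram_determinant_real2:
  fixes x y z :: "real^2"
  shows "(x \<bullet> x) * (y \<bullet> y) * (z \<bullet> z) + 2 * (x \<bullet> y) * (y \<bullet> z) * (x \<bullet> z)
    = (x \<bullet> x) * (y \<bullet> z)\<^sup>2 + (y \<bullet> y) * (x \<bullet> z)\<^sup>2 + (z \<bullet> z) * (x \<bullet> y)\<^sup>2"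
  unfolding inner_vec_def sum_2 inner_real_def by algebra

lemma dist_sq_add:
  fixes P u v :: "'a::real_inner"
  shows "(dist (P + u) (P + v))\<^sup>2 = u \<bullet> u + v \<bullet> v - 2 * (u \<bullet> v)"
  by (simp add: dist_norm power2_norm_eq_inner inner_diff_left inner_diff_right inner_commute)

text \<open>The inner product is recorded along with the center because it completes the Gram matrix
  of two circumradius vectors, needed for the power sum.\<close>

lemma equilateral_circumcenter:
  assumes "equilateral_triangle A" and "\<forall>i\<in>{1..3}. A i \<in> sphere P R"
  shows "P = centroid A"
    and "(A 1 - P) \<bullet> (A 2 - P) = - R\<^sup>2 / 2"
proof -
  define u where "u i = A i - P" for i
  have A: "A i = P + u i" for i
    by (simp add: u_def)
  have n: "u i \<bullet> u i = R\<^sup>2" if "i \<in> {1..3}" for i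
    using assms(2) that by (auto simp: u_def dist_norm norm_minus_commute simp flip: power2_norm_eq_inner)
  have n': "u 1 \<bullet> u 1 = R\<^sup>2" "u 2 \<bullet> u 2 = R\<^sup>2" "u 3 \<bullet> u 3 = R\<^sup>2"
    by (simp_all add: n)
  define k where "k = u 1 \<bullet> u 2"
  have d: "(dist (A 1) (A 2))\<^sup>2 = (dist (A 2) (A 3))\<^sup>2" "(dist (A 1) (A 2))\<^sup>2 = (dist (A 1) (A 3))\<^sup>2"
    using assms(1) by (simp_all add: equilateral_triangle_def dist_commute)
  \<comment> \<open>With all \<open>u i\<close> of equal norm, equal sides amount to equal pairwise
    inner products.\<close>
  have k: "u 1 \<bullet> u 2 = k" "u 2 \<bullet> u 3 = k" "u 1 \<bullet> u 3 = k"
    using d unfolding A dist_sq_add n' by (simp_all add: k_def)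
  have ne: "k \<noteq> R\<^sup>2"
  proof
    assume "k = R\<^sup>2"
    then have "(dist (A 1) (A 2))\<^sup>2 = 0"
      unfolding A dist_sq_add n' k by simp
    then have "A 1 = A 2"
      by simp
    then have "collinear {A 1, A 2, A 3}"
      by simp
    then show False
      using assms(1) by (simp add: equilateral_triangle_def)
  qed
  \<comment> \<open>This product is the determinant of the 3 by 3 matrix with
    \<open>R\<^sup>2\<close> on the diagonal and \<open>k\<close> elsewhere; \<open>ne\<close>
    allows cancelling its first factor.\<close>
  have "(R\<^sup>2 - k)\<^sup>2 * (R\<^sup>2 + 2 * k) = 0"
    using gram_determinant_real2[of "u 1" "u 2" "u 3"] unfolding n' k by algebra
  with ne have kR: "R\<^sup>2 + 2 * k = 0"
    by simp
  \<comment> \<open>The remaining factor reappears as a third of the squared norm of the sum, which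
    therefore vanishes.\<close>
  have "(u 1 + u 2 + u 3) \<bullet> (u 1 + u 2 + u 3) = 3 * (R\<^sup>2 + 2 * k)"
    by (simp add: inner_add_left inner_add_right n' k inner_commute[of "u 2" "u 1"]
        inner_commute[of "u 3" "u 1"] inner_commute[of "u 3" "u 2"]
        del: One_nat_def)
  then have s: "u 1 + u 2 + u 3 = 0"
    by (simp add: kR)
  have "(\<Sum>i=1..3. A i) = A 1 + A 2 + A 3"
    by (simp add: numeral_3_eq_3 numeral_2_eq_2)
  also have "\<dots> = 3 *\<^sub>R P + (u 1 + u 2 + u 3)"
    by (simp add: A vec_eq_iff)
  finally show "P = centroid A"
    unfolding s by (simp add: centroid_def)
  show "(A 1 - P) \<bullet> (A 2 - P) = - R\<^sup>2 / 2"
    using kR k by (simp flip: u_def)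
qed

lemma sum_dist_pow4_equilateral:
  fixes A :: "nat \<Rightarrow> real^2"
  assumes "equilateral_triangle A" and "is_circumradius R A" and "R > 0"
  shows "(\<Sum>i=1..3. dist M (A i) ^ 4)
    = 3 * (((dist M (centroid A))\<^sup>2 + 2 * R\<^sup>2)\<^sup>2 - 3 * R^4)"
proof -
  define P where "P = centroid A"
  obtain Q where Q: "\<forall>i\<in>{1..3}. A i \<in> sphere Q R"
    using assms(2) by (auto simp: is_circumradius_def)
  note c = equilateral_circumcenter[OF assms(1) Q]
  have QP: "Q = P"
    using c(1) by (simp add: P_def)
  define u where "u i = A i - P" for i
  define x where "x = M - P"
  have M: "M = P + x" and A: "A i = P + u i" for i
    by (simp_all add: x_def u_def)
  have n: "u i \<bullet> u i = R\<^sup>2" if "i \<in> {1..3}" for i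
    using Q that unfolding QP
    by (auto simp: u_def dist_norm norm_minus_commute simp flip: power2_norm_eq_inner)
  have n': "u 1 \<bullet> u 1 = R\<^sup>2" "u 2 \<bullet> u 2 = R\<^sup>2" "u 3 \<bullet> u 3 = R\<^sup>2"
    by (simp_all add: n)
  have k: "u 1 \<bullet> u 2 = - R\<^sup>2 / 2"
    using c(2) by (simp add: u_def QP)
  have "3 *\<^sub>R P = A 1 + A 2 + A 3"
    by (simp add: P_def centroid_def numeral_3_eq_3 numeral_2_eq_2)
  \<comment> \<open>Eliminating \<open>u 3\<close> leaves only the two unknowns \<open>a\<close> and
    \<open>b\<close>.\<close>
  then have u3: "u 3 = - u 1 - u 2"
    by (simp add: u_def vec_eq_iff algebra_simps)
  define s a b where "s = x \<bullet> x" and "a = x \<bullet> u 1" and "b = x \<bullet> u 2"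
  have x3: "x \<bullet> u 3 = - a - b"
    by (simp add: u3 a_def b_def inner_diff_right)
  \<comment> \<open>The common factor \<open>R\<^sup>2\<close> is kept so that \<open>R > 0\<close>
    can cancel it afterwards.\<close>
  have "R\<^sup>2 * (a\<^sup>2 + a * b + b\<^sup>2) = R\<^sup>2 * (3 / 4 * R\<^sup>2 * s)"
    using gram_determinant_real2[of x "u 1" "u 2"]
    unfolding n' k a_def[symmetric] b_def[symmetric] s_def[symmetric]
    by (simp add: power2_eq_square field_simps)
  then have ab: "a\<^sup>2 + a * b + b\<^sup>2 = 3 / 4 * R\<^sup>2 * s"
    using assms(3) by simp
  have p4: "dist M (A i) ^ 4 = (s + u i \<bullet> u i - 2 * (x \<bullet> u i))\<^sup>2" for i
  proof -
    have "dist M (A i) ^ 4 = ((dist M (A i))\<^sup>2)\<^sup>2"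
      by simp
    then show ?thesis
      unfolding M A s_def dist_sq_add .
  qed
  have "(\<Sum>i=1..3. dist M (A i) ^ 4) = dist M (A 1) ^ 4 + dist M (A 2) ^ 4 + dist M (A 3) ^ 4"
    by (simp add: numeral_3_eq_3 numeral_2_eq_2)
  also have "\<dots> = (s + R\<^sup>2 - 2 * a)\<^sup>2 + (s + R\<^sup>2 - 2 * b)\<^sup>2 + (s + R\<^sup>2 + 2 * (a + b))\<^sup>2"
    unfolding p4 n' x3 by (simp add: a_def b_def algebra_simps)
  \<comment> \<open>The cross terms cancel because \<open>a\<close>, \<open>b\<close> and
    \<open>- (a + b)\<close> sum to zero; what remains is exactly the quadratic form known from
    \<open>ab\<close>.\<close>
  also have "\<dots> = 3 * (s + R\<^sup>2)\<^sup>2 + 8 * (a\<^sup>2 + a * b + b\<^sup>2)"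
    by algebra
  also have "\<dots> = 3 * ((s + 2 * R\<^sup>2)\<^sup>2 - 3 * R^4)"
    unfolding ab by (simp add: power2_eq_square power4_eq_xxxx algebra_simps)
  also have "s = (dist M P)\<^sup>2"
    by (simp add: s_def x_def dist_norm power2_norm_eq_inner)
  finally show ?thesis
    by (simp add: P_def)
qed

theorem theorem1p1:
  fixes A :: "nat \<Rightarrow> real^2" and R c :: real
  assumes "equilateral_triangle A"
    and "is_circumradius R A" and "R > 0"
    and "c > 3 * R^4"
  shows "\<exists>r>0. {M :: real^2. (\<Sum>i=1..3. dist M (A i) ^ 4) = c} = sphere (centroid A) r"
proof -
  \<comment> \<open>\<open>t\<close> is the value that \<open>e\<^sup>2 + 2 * R\<^sup>2\<close> must
    take: the nonnegative root of \<open>3 * (t\<^sup>2 - 3 * R^4) = c\<close>.\<close>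
  define t where "t = sqrt (c / 3 + 3 * R^4)"
  have R4: "(2 * R\<^sup>2)\<^sup>2 = 4 * R^4" "R^4 > 0"
    using assms(3) by (simp_all add: power_mult_distrib)
  have t2: "t\<^sup>2 = c / 3 + 3 * R^4"
    unfolding t_def using assms(4) R4(2) by (intro real_sqrt_pow2) linarith
  \<comment> \<open>The bound \<open>c > 3 * R^4\<close> says precisely that
    \<open>t\<^sup>2\<close> exceeds \<open>4 * R^4\<close>, which makes the radius \<open>r\<close>
    positive.\<close>
  have t0: "t > 2 * R\<^sup>2"
    unfolding t_def by (rule real_less_rsqrt) (use R4 assms(4) in simp)
  have t_nonneg: "t \<ge> 0"
    unfolding t_def using R4(2) assms(4) by (intro real_sqrt_ge_zero) linarith
  define r where "r = sqrt (t - 2 * R\<^sup>2)"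
  have r: "r > 0" "r\<^sup>2 = t - 2 * R\<^sup>2"
    using t0 by (simp_all add: r_def)
  have "(\<Sum>i=1..3. dist M (A i) ^ 4) = c \<longleftrightarrow> dist (centroid A) M = r" for M
  proof -
    define e where "e = dist M (centroid A)"
    have "(\<Sum>i=1..3. dist M (A i) ^ 4) = c \<longleftrightarrow> (e\<^sup>2 + 2 * R\<^sup>2)\<^sup>2 = t\<^sup>2"
      unfolding sum_dist_pow4_equilateral[OF assms(1-3)] t2 e_def by argo
    also have "\<dots> \<longleftrightarrow> e\<^sup>2 + 2 * R\<^sup>2 = t"
      using t_nonneg by (intro power2_eq_iff_nonneg) auto
    also have "\<dots> \<longleftrightarrow> e\<^sup>2 = r\<^sup>2"
      unfolding r(2) by argo
    also have "\<dots> \<longleftrightarrow> e = r"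
      using r(1) by (intro power2_eq_iff_nonneg) (auto simp: e_def)
    finally show ?thesis
      by (simp add: e_def dist_commute)
  qed
  then have "{M. (\<Sum>i=1..3. dist M (A i) ^ 4) = c} = sphere (centroid A) r"
    unfolding sphere_def by presburger
  with r(1) show ?thesis
    by blast
qed

end
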